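(* The randomized value-query complexity of finding an EFX allocation satisfies $$R_{\mathrm{sub}}[EFX_{id}(2,2k+1)]\in\Omega\!\left(\sqrt{\binom{2k+1}{k}}\,\frac{1}{k^2}\right).$$ Here there are two players who share one identical submodular valuation on $2k+1$ goods.
   Context: Goods form a finite set $M$. A valuation is a function $v:2^M\to\mathbb{R}_{\ge 0}$ with $v(\emptyset)=0$ that is monotone: $v(S)\le v(T)$ whenever $S\subseteq T$. It is submodular if $v(S\cup\{x\})-v(S)\ge v(T\cup\{x\})-v(T)$ for all $S\subseteq T$ and $x\notin T$. An allocation is an ordered partition $(A_1,\dots,A_n)$ of $M$; parts may be empty. It is EFX if for all players $i,j$ and every $g\in A_j$ we have $v_i(A_i)\ge v_i(A_j\setminus\{g\})$. $R_{\mathrm{sub}}[EFX_{id}(n,m)]$ is defined as follows. All $n$ players share one submodular valuation $v$ on $M=[m]$. A randomized algorithm learns about $v$ only through adaptive value queries, where querying a set $S$ returns $v(S)$. It must output an EFX allocation with probability at least $2/3$ over its internal randomness, for every $v$. The quantity is the minimum, over such algorithms, of the worst-case number of queries. *)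

theory Defs
  imports "HOL-Probability.Probability"
begin

definition goods :: "nat \<Rightarrow> nat set" where
  "goods m = {..<m}"

definition valuation :: "nat \<Rightarrow> (nat set \<Rightarrow> real) \<Rightarrow> bool" where
  "valuation m v \<longleftrightarrow> v {} = 0 \<and> (\<forall>S. S \<subseteq> goods m \<longrightarrow> v S \<ge> 0)
     \<and> (\<forall>S T. S \<subseteq> T \<and> T \<subseteq> goods m \<longrightarrow> v S \<le> v T)"

definition submodular :: "nat \<Rightarrow> (nat set \<Rightarrow> real) \<Rightarrow> bool" where
  "submodular m v \<longleftrightarrow> (\<forall>S T x. S \<subseteq> T \<and> T \<subseteq> goods m \<and> x \<in> goods m \<and> x \<notin> T \<longrightarrow>
       v (S \<union> {x}) - v S \<ge> v (T \<union> {x}) - v T)"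

definition submod_valuation :: "nat \<Rightarrow> (nat set \<Rightarrow> real) \<Rightarrow> bool" where
  "submod_valuation m v \<longleftrightarrow> valuation m v \<and> submodular m v"

definition is_allocation :: "nat \<Rightarrow> nat \<Rightarrow> (nat \<Rightarrow> nat set) \<Rightarrow> bool" where
  "is_allocation n m A \<longleftrightarrow> (\<forall>i<n. A i \<subseteq> goods m)
     \<and> (\<forall>i<n. \<forall>j<n. i \<noteq> j \<longrightarrow> A i \<inter> A j = {})
     \<and> (\<Union>i<n. A i) = goods m"

definition is_EFX_id :: "nat \<Rightarrow> nat \<Rightarrow> (nat set \<Rightarrow> real) \<Rightarrow> (nat \<Rightarrow> nat set) \<Rightarrow> bool" where
  "is_EFX_id n m v A \<longleftrightarrow> is_allocation n m A \<and>
     (\<forall>i<n. \<forall>j<n. \<forall>g\<in>A j. v (A i) \<ge> v (A j - {g}))"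

text \<open>Deterministic adaptive value-query algorithms: decision trees whose inner
  nodes query a set and branch on the real answer, leaves output an allocation.\<close>
datatype qtree = Leaf "nat \<Rightarrow> nat set" | Query "nat set" "real \<Rightarrow> qtree"

text \<open>The query set is intersected with the ground set, so queries only reveal v on subsets of M.\<close>
primrec qout :: "qtree \<Rightarrow> nat \<Rightarrow> (nat set \<Rightarrow> real) \<Rightarrow> (nat \<Rightarrow> nat set)" where
  "qout (Leaf A) m v = A"
| "qout (Query S f) m v = qout (f (v (S \<inter> goods m))) m v"

primrec qcount :: "qtree \<Rightarrow> nat \<Rightarrow> (nat set \<Rightarrow> real) \<Rightarrow> nat" where
  "qcount (Leaf A) m v = 0"
| "qcount (Query S f) m v = Suc (qcount (f (v (S \<inter> goods m))) m v)"

text \<open>A randomized algorithm: a probability space of random seeds (infinite bit strings,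
  with an arbitrary probability measure) and a map from seeds to deterministic trees.\<close>
type_synonym seed = "nat \<Rightarrow> bool"

definition rand_correct :: "nat \<Rightarrow> nat \<Rightarrow> seed measure \<Rightarrow> (seed \<Rightarrow> qtree) \<Rightarrow> bool" where
  "rand_correct n m P Alg \<longleftrightarrow> prob_space P \<and>
     (\<forall>v. submod_valuation m v \<longrightarrow>
        (let E = {\<omega> \<in> space P. is_EFX_id n m v (qout (Alg \<omega>) m v)} in
          E \<in> sets P \<and> measure P E \<ge> 2/3))"

definition worst_cost :: "nat \<Rightarrow> seed measure \<Rightarrow> (seed \<Rightarrow> qtree) \<Rightarrow> ennreal" where
  "worst_cost m P Alg = (SUP v \<in> {v. submod_valuation m v}. SUP \<omega> \<in> space P.
      of_nat (qcount (Alg \<omega>) m v))"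

definition R_sub_EFX_id :: "nat \<Rightarrow> nat \<Rightarrow> ennreal" where
  "R_sub_EFX_id n m = (INF PA \<in> {(P, Alg). rand_correct n m P Alg}. worst_cost m (fst PA) (snd PA))"

end

theory Submission
  imports Defs "HOL-Combinatorics.Permutations"
begin

text \<open>
  If \<open>v S\<close> depends only on \<open>card S\<close> except on the \<open>k\<close>-sets, the smaller bundle of an EFX allocation
  is a local maximum of \<open>v\<close> on the odd graph, whose vertices are the \<open>k\<close>-sets and whose edges are the
  disjoint pairs. Rank the vertices of a walk by their last visit and all other vertices, below them, by
  proximity to the start: the end of the walk is then the only local maximum. Take a random walk
  made of \<open>q + 1\<close> segments of length \<open>2 * k\<close>, such that each position of a segment is uniform over the
  \<open>N\<close> vertices even when everything before the preceding segment is known. Revealing one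
  segment for free before each query, \<open>q\<close> queries hit a segment that is still unpredictable with
  probability at most \<open>2 * k * q\<^sup>2 / N\<close>, and otherwise the end is guessed with probability at most
  \<open>2 / N\<close>. Averaging over the walk gives \<open>2 / 3 \<le> (2 * k * q\<^sup>2 + 2) / N\<close>.
\<close>

section \<open>Decision trees\<close>

primrec queries :: "qtree \<Rightarrow> nat \<Rightarrow> (nat set \<Rightarrow> real) \<Rightarrow> nat set list" where
  "queries (Leaf A) m v = []"
| "queries (Query S f) m v = (S \<inter> goods m) # queries (f (v (S \<inter> goods m))) m v"

lemma length_queries: "length (queries t m v) = qcount t m v"
  by (induction t) auto

text \<open>In an adaptive run the next query is determined by the answers so far; hence agreement
  on \<open>i\<close> queries already fixes query number \<open>i\<close>, counted from 0.\<close>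

lemma queries_agree:
  assumes "\<forall>S \<in> set (take i (queries t m v)). v S = v' S"
  shows "take (Suc i) (queries t m v) = take (Suc i) (queries t m v')"
  using assms
proof (induction t arbitrary: i)
  case (Leaf A)
  then show ?case by simp
next
  case (Query S f)
  show ?case
  proof (cases i)
    case (Suc j)
    with Query.prems have eq: "v (S \<inter> goods m) = v' (S \<inter> goods m)"
      and rest: "\<forall>S' \<in> set (take j (queries (f (v (S \<inter> goods m))) m v)). v S' = v' S'"
      by auto
    show ?thesis
      using Query.IH[OF _ rest] eq Suc by auto
  qed simp
qed

lemma qout_agree:
  assumes "\<forall>S \<in> set (queries t m v). v S = v' S"
  shows "qout t m v = qout t m v'"
  using assms by (induction t) auto

section \<open>Fibre counting for permutations\<close>

text \<open>Composing with a permutation that carries \<open>C\<close> to \<open>D\<close> injects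
  the fibre over \<open>C\<close> into the fibre over \<open>D\<close>. So all fibres of the action
  on \<open>r\<close>-sets are equally large.\<close>

lemma card_permutes_image_eq:
  assumes fin: "finite X" and A: "A \<subseteq> X" "card A = r" and B: "B \<subseteq> X" "card B = r"
  shows "card {g. g permutes X \<and> g ` A = B} * (card X choose r) = card {g. g permutes X}"
proof -
  let ?V = "{S. S \<subseteq> X \<and> card S = r}"
  let ?F = "\<lambda>C. {g. g permutes X \<and> g ` A = C}"
  have finP: "finite {g. g permutes X}"
    by (rule finite_permutations[OF fin])
  have le: "card (?F C) \<le> card (?F D)" if C: "C \<in> ?V" and D: "D \<in> ?V" for C D
  proof -
    have finC: "finite C" "finite D" and CD: "card C = card D" "card (X - C) = card (X - D)"
      using C D fin by (auto intro: finite_subset simp: card_Diff_subset finite_subset)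
    obtain p where p: "bij_betw p C D"
      using finite_same_card_bij[OF finC CD(1)] by blast
    obtain q where q: "bij_betw q (X - C) (X - D)"
      using finite_same_card_bij[OF _ _ CD(2)] fin by blast
    define r where "r = (\<lambda>x. if x \<in> C then p x else if x \<in> X then q x else x)"
    have rC: "bij_betw r C D"
      using p by (subst bij_betw_cong[of _ _ p]) (auto simp: r_def)
    have rXC: "bij_betw r (X - C) (X - D)"
      using q by (subst bij_betw_cong[of _ _ q]) (auto simp: r_def)
    have "bij_betw r (C \<union> (X - C)) (D \<union> (X - D))"
      by (rule bij_betw_combine[OF rC rXC]) auto
    then have "bij_betw r X X"
      using C D by (simp add: Un_absorb1)
    then have r: "r permutes X"
      using C by (intro bij_imp_permutes) (auto simp: r_def)
    have "inj_on ((\<circ>) r) (?F C)"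
      by (rule inj_onI) (auto simp: fun_eq_iff dest: injD[OF permutes_inj[OF r]])
    moreover have "(\<circ>) r ` ?F C \<subseteq> ?F D"
    proof
      fix g assume "g \<in> (\<circ>) r ` ?F C"
      then obtain g0 where g0: "g0 permutes X" "g0 ` A = C" "g = r \<circ> g0" by auto
      then have "g ` A = r ` C" by (metis image_comp)
      then show "g \<in> ?F D"
        using g0 r rC permutes_compose by (auto simp: bij_betw_def)
    qed
    moreover have "finite (?F D)"
      by (rule finite_subset[OF _ finP]) auto
    ultimately show ?thesis
      by (rule card_inj_on_le)
  qed
  have eq: "card (?F C) = card (?F B)" if "C \<in> ?V" for C
    using le[of C B] le[of B C] that B by auto
  have "g ` A \<in> ?V" if "g permutes X" for g
    using A image_mono[of A X g] permutes_image[OF that] permutes_inj_on[OF that]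
    by (simp add: card_image)
  then have "{g. g permutes X} = (\<Union>C\<in>?V. ?F C)"
    by auto
  moreover have "card (\<Union>C\<in>?V. ?F C) = (\<Sum>C\<in>?V. card (?F C))"
    using fin by (intro card_UN_disjoint) (auto intro: finite_subset[OF _ finP])
  moreover have "\<dots> = card ?V * card (?F B)"
    using eq by simp
  moreover have "card ?V = card X choose r"
    by (rule n_subsets[OF fin])
  ultimately show ?thesis
    by (simp add: mult.commute)
qed

text \<open>Conditioning on all coordinates but \<open>i\<close>: a conditional probability of at
  most \<open>1 / N\<close> for every choice of the others gives the same bound overall.\<close>

lemma card_PiE_fibre_bound:
  fixes N :: nat
  assumes fin: "finite I" "finite G" and i: "i \<in> I"
    and fibre: "\<And>h. h \<in> I \<rightarrow>\<^sub>E G \<Longrightarrow> card {g \<in> G. Q (h(i := g))} * N \<le> card G"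
  shows "card {h \<in> I \<rightarrow>\<^sub>E G. Q h} * N \<le> card (I \<rightarrow>\<^sub>E G)"
proof -
  let ?J = "I - {i}"
  let ?c = "\<lambda>(g, h). h(i := g)"
  have I: "I = insert i ?J" using i by auto
  have inj: "inj_on ?c (G \<times> (?J \<rightarrow>\<^sub>E G))"
    using inj_combinator[of i ?J "\<lambda>_. G"] by simp
  have finJ: "finite (?J \<rightarrow>\<^sub>E G)"
    using fin by (intro finite_PiE) auto
  have all: "I \<rightarrow>\<^sub>E G = ?c ` (G \<times> (?J \<rightarrow>\<^sub>E G))"
    by (subst I) (rule PiE_insert_eq)
  have "{h \<in> I \<rightarrow>\<^sub>E G. Q h} = ?c ` {(g, h) \<in> G \<times> (?J \<rightarrow>\<^sub>E G). Q (h(i := g))}"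
    unfolding all by auto
  then have "card {h \<in> I \<rightarrow>\<^sub>E G. Q h} = card {(g, h) \<in> G \<times> (?J \<rightarrow>\<^sub>E G). Q (h(i := g))}"
    by (simp add: card_image[OF inj_on_subset[OF inj]] subset_iff)
  also have "\<dots> = card ((\<lambda>(g, h). (h, g)) ` {(g, h) \<in> G \<times> (?J \<rightarrow>\<^sub>E G). Q (h(i := g))})"
    by (rule card_image[symmetric]) (auto intro: inj_onI)
  also have "(\<lambda>(g, h). (h, g)) ` {(g, h) \<in> G \<times> (?J \<rightarrow>\<^sub>E G). Q (h(i := g))}
      = (SIGMA h : ?J \<rightarrow>\<^sub>E G. {g \<in> G. Q (h(i := g))})"
    by force
  also have "card \<dots> = (\<Sum>h \<in> ?J \<rightarrow>\<^sub>E G. card {g \<in> G. Q (h(i := g))})"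
    using finJ fin by (intro card_SigmaI) auto
  finally have "card {h \<in> I \<rightarrow>\<^sub>E G. Q h} * N = (\<Sum>h \<in> ?J \<rightarrow>\<^sub>E G. card {g \<in> G. Q (h(i := g))} * N)"
    by (simp add: sum_distrib_right)
  also have "\<dots> \<le> (\<Sum>h \<in> ?J \<rightarrow>\<^sub>E G. card G)"
  proof (intro sum_mono)
    fix h assume h: "h \<in> ?J \<rightarrow>\<^sub>E G"
    show "card {g \<in> G. Q (h(i := g))} * N \<le> card G"
    proof (cases "G = {}")
      case False
      \<comment> \<open>\<open>fibre\<close> wants a function on all of \<open>I\<close>; the value
        \<open>g0\<close> put at \<open>i\<close> is overwritten again.\<close>
      then obtain g0 where "g0 \<in> G" by blast
      with h have "h(i := g0) \<in> I \<rightarrow>\<^sub>E G"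
        using i by (auto simp: PiE_iff extensional_def)
      from fibre[OF this] show ?thesis by simp
    qed simp
  qed
  also have "\<dots> = card (I \<rightarrow>\<^sub>E G)"
    unfolding all by (simp add: card_image[OF inj] card_cartesian_product)
  finally show ?thesis .
qed

section \<open>Local maxima on the odd graph\<close>

locale odd_graph =
  fixes k :: nat
  assumes k_pos: "0 < k"
begin

definition M :: "nat set" where "M = goods (2 * k + 1)"

definition V :: "nat set set" where "V = {S. S \<subseteq> M \<and> card S = k}"

text \<open>Loops are included so that walks can be padded to a prescribed length.\<close>
definition E :: "(nat set \<times> nat set) set" where
  "E = {(A, B). A \<in> V \<and> B \<in> V \<and> (A = B \<or> A \<inter> B = {})}"

definition root :: "nat set" where "root = {..<k}"

definition depth :: "nat set \<Rightarrow> nat" where "depth S = (LEAST d. (S, root) \<in> E ^^ d)"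

lemma finite_M: "finite M" and card_M: "card M = 2 * k + 1"
  by (auto simp: M_def goods_def)

lemma V_D: "S \<in> V \<Longrightarrow> S \<subseteq> M" "S \<in> V \<Longrightarrow> card S = k" "S \<in> V \<Longrightarrow> finite S"
  by (auto simp: V_def intro: finite_subset[OF _ finite_M])

lemma root_V: "root \<in> V"
  by (auto simp: root_def V_def M_def goods_def)

lemma E_refl: "A \<in> V \<Longrightarrow> (A, A) \<in> E"
  by (simp add: E_def)

lemma E_pow_pad:
  assumes "(A, B) \<in> E ^^ i" "B \<in> V" "i \<le> j"
  shows "(A, B) \<in> E ^^ j"
  using assms(3,1) by (induction rule: dec_induct) (auto intro: relcompI E_refl[OF assms(2)])

text \<open>The two sets have a union of size \<open>k + 1\<close>, whose complement has size
  \<open>k\<close> and is a common neighbour.\<close>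

lemma swap_path:
  assumes A: "A \<in> V" and a: "a \<in> A" and b: "b \<in> M" "b \<notin> A"
  shows "(A, insert b (A - {a})) \<in> E ^^ 2"
proof -
  let ?C = "M - insert b A" and ?B = "insert b (A - {a})"
  have "card ?C = card M - card (insert b A)"
    using A b by (intro card_Diff_subset) (auto simp: V_D)
  then have C: "?C \<in> V"
    using A b by (auto simp: V_def card_M card_insert_if finite_subset[OF _ finite_M])
  have "card ?B = k"
    using A a b k_pos by (simp add: V_D card_insert_if card_Diff_singleton)
  then have B: "?B \<in> V"
    using A b V_D(1)[OF A] by (auto simp: V_def)
  have "(A, ?C) \<in> E" "(?C, ?B) \<in> E"
    using A B C by (auto simp: E_def)
  then show ?thesis
    by (auto simp: numeral_2_eq_2)
qed

text \<open>At most \<open>k\<close> swaps of two steps each lead from \<open>A\<close> to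
  \<open>B\<close>; loops pad the path to length exactly \<open>2 * k\<close>.\<close>

lemma E_pow_connected:
  assumes "A \<in> V" "B \<in> V"
  shows "(A, B) \<in> E ^^ (2 * k)"
proof -
  have "(A, B) \<in> E ^^ (2 * card (A - B))"
    using assms(1)
  proof (induction "card (A - B)" arbitrary: A)
    case 0
    then have "A \<subseteq> B"
      by (auto simp: V_D)
    then have "A = B"
      using 0 assms(2) by (metis V_D(2,3) card_subset_eq)
    then show ?case by simp
  next
    case (Suc n)
    then obtain a where a: "a \<in> A" "a \<notin> B"
      by (metis DiffE all_not_in_conv card.empty nat.distinct(1))
    have "card (B - A) = card (A - B)"
      using Suc.prems assms(2) by (metis V_D(2,3) card_Diff_subset_Int inf_commute finite_Int)
    then obtain b where b: "b \<in> B" "b \<notin> A"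
      using Suc.hyps(2) by (metis DiffE all_not_in_conv card.empty nat.distinct(1))
    let ?A = "insert b (A - {a})"
    have step: "(A, ?A) \<in> E ^^ 2"
      using Suc.prems a b assms(2) by (intro swap_path) (auto dest: V_D)
    then have "?A \<in> V"
      by (auto simp: numeral_2_eq_2 E_def)
    moreover have "?A - B = (A - B) - {a}"
      using b by auto
    then have n: "n = card (?A - B)"
      using Suc.hyps(2) Suc.prems a by (simp add: V_D)
    ultimately have "(?A, B) \<in> E ^^ (2 * n)"
      using Suc.hyps(1) by blast
    with step have "(A, B) \<in> E ^^ 2 O E ^^ (2 * n)"
      by auto
    then show ?case
      unfolding relpow_add[symmetric] Suc.hyps(2)[symmetric] by simp
  qed
  moreover have "card (A - B) \<le> k"
    using assms by (metis V_D(2,3) card_mono Diff_subset)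
  ultimately show ?thesis
    using E_pow_pad assms(2) by simp
qed

lemma depth_descent:
  assumes "S \<in> V" "S \<noteq> root"
  obtains S' where "S' \<in> V" "S \<inter> S' = {}" "depth S' < depth S"
proof -
  have pow: "(S, root) \<in> E ^^ depth S"
    unfolding depth_def by (rule LeastI) (rule E_pow_connected[OF assms(1) root_V])
  then obtain d where d: "depth S = Suc d"
    using assms(2) by (cases "depth S") auto
  with pow obtain S' where S': "(S, S') \<in> E" "(S', root) \<in> E ^^ d"
    by (metis relpow_Suc_D2)
  then have less: "depth S' < depth S"
    unfolding d less_Suc_eq_le by (subst depth_def) (rule Least_le)
  then have "S \<noteq> S'" by auto
  with S' less that show thesis by (auto simp: E_def)
qed

section \<open>Walks and the heights they induce\<close>

definition walk :: "(nat \<Rightarrow> nat set) \<Rightarrow> nat \<Rightarrow> bool" where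
  "walk w T \<longleftrightarrow> w 0 = root \<and> (\<forall>i<T. (w i, w (Suc i)) \<in> E)"

text \<open>Visited vertices are ranked by their last visit and lie above all other vertices, which are
  ranked by proximity to the root.\<close>
definition height :: "(nat \<Rightarrow> nat set) \<Rightarrow> nat \<Rightarrow> nat set \<Rightarrow> real" where
  "height w T S = (if S \<in> w ` {..T} then 1 - 1 / (real (Max {i. i \<le> T \<and> w i = S}) + 2)
     else 1 / (real (depth S) + 2))"

lemma height_range: "0 \<le> height w T S" "height w T S \<le> 1"
  by (auto simp: height_def field_simps)

text \<open>An unvisited vertex lies below its neighbour closer to the root. A visited vertex last
  left at time \<open>i < T\<close> lies below \<open>w (Suc i)\<close>, whose last visit is
  later.\<close>

lemma height_local_max:
  assumes w: "walk w T" and S: "S \<in> V"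
    and max: "\<And>S'. S' \<in> V \<Longrightarrow> S \<inter> S' = {} \<Longrightarrow> height w T S' \<le> height w T S"
  shows "S = w T"
proof (cases "S \<in> w ` {..T}")
  case False
  then have "S \<noteq> root"
    using w by (auto simp: walk_def)
  then obtain S' where S': "S' \<in> V" "S \<inter> S' = {}" "depth S' < depth S"
    using depth_descent S by blast
  have low: "height w T S = 1 / (real (depth S) + 2)"
    using False by (simp add: height_def)
  \<comment> \<open>Visited heights start at 1/2 and unvisited ones reach 1/2 only at depth 0, so
    positive depth separates them strictly.\<close>
  have "depth S > 0" using S' by simp
  have "height w T S < height w T S'"
  proof (cases "S' \<in> w ` {..T}")
    case True
    have "height w T S < 1 / 2"
      unfolding low using \<open>depth S > 0\<close> by (simp add: field_simps)
    also have "1 / 2 \<le> height w T S'"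
      using True by (auto simp: height_def field_simps)
    finally show ?thesis .
  next
    case False
    then show ?thesis
      unfolding low using S' by (auto simp: height_def intro!: divide_strict_left_mono)
  qed
  with max S' show ?thesis by force
next
  case True
  define i where "i = Max {i. i \<le> T \<and> w i = S}"
  have fin: "finite {i. i \<le> T \<and> w i = X}" for X
    by (rule finite_subset[of _ "{..T}"]) auto
  have "{i. i \<le> T \<and> w i = S} \<noteq> {}"
    using True by auto
  from Max_in[OF fin this] have i: "i \<le> T" "w i = S"
    unfolding i_def by auto
  show ?thesis
  proof (cases "i = T")
    case False
    with i have iT: "Suc i \<le> T" by simp
    \<comment> \<open>The walk may use loops, but not right after the last visit; so this edge joins
      disjoint sets.\<close>
    have ne: "w (Suc i) \<noteq> S"
    proof
      assume "w (Suc i) = S"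
      then have "Suc i \<le> i"
        unfolding i_def[symmetric] using iT by (subst (2) i_def) (intro Max_ge fin, simp)
      then show False by simp
    qed
    have E: "(S, w (Suc i)) \<in> E"
      using w i iT by (auto simp: walk_def)
    let ?j = "Max {j. j \<le> T \<and> w j = w (Suc i)}"
    have "Suc i \<le> ?j"
      using iT by (intro Max_ge fin) simp
    then have "1 / (real ?j + 2) < 1 / (real i + 2)"
      by (intro divide_strict_left_mono) auto
    then have "height w T S < height w T (w (Suc i))"
      using True iT by (auto simp: height_def i_def[symmetric])
    moreover have "height w T (w (Suc i)) \<le> height w T S"
      using E ne by (intro max) (auto simp: E_def)
    ultimately show ?thesis by simp
  qed (use i in simp)
qed

text \<open>This is what makes a query cheap to answer: unless it hits the later part of the walk,
  the known prefix determines the answer.\<close>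

lemma height_truncate:
  assumes "T \<le> T'" "\<And>i. T < i \<Longrightarrow> i \<le> T' \<Longrightarrow> w i \<noteq> S"
  shows "height w T' S = height w T S"
proof -
  have "i \<le> T' \<and> w i = S \<longleftrightarrow> i \<le> T \<and> w i = S" for i
    using assms(1) assms(2)[of i] by (cases "i \<le> T") auto
  then have "{i. i \<le> T' \<and> w i = S} = {i. i \<le> T \<and> w i = S}"
    by simp
  moreover from this have "S \<in> w ` {..T'} \<longleftrightarrow> S \<in> w ` {..T}"
    by (auto simp: set_eq_iff)
  ultimately show ?thesis
    by (simp add: height_def)
qed

lemma height_cong:
  assumes "\<And>i. i \<le> T \<Longrightarrow> w i = w' i"
  shows "height w T = height w' T"
proof
  fix S
  have "{i. i \<le> T \<and> w i = S} = {i. i \<le> T \<and> w' i = S}" "w ` {..T} = w' ` {..T}"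
    using assms by auto
  then show "height w T S = height w' T S"
    by (simp add: height_def)
qed

section \<open>Hard valuations\<close>

definition val :: "(nat set \<Rightarrow> real) \<Rightarrow> nat set \<Rightarrow> real" where
  "val f S = (if card S < k then 2 * real (card S)
     else if card S = k then 2 * real k - 1 + f S else 2 * real k)"

text \<open>Marginal gains are 2 at sizes below \<open>k - 1\<close>, in [1, 2] at size
  \<open>k - 1\<close>, in [0, 1] at size \<open>k\<close>, and 0 above. They decrease with the size
  whatever \<open>f\<close> is.\<close>

lemma submod_valuation_val:
  assumes f: "\<And>S. 0 \<le> f S" "\<And>S. f S \<le> 1"
  shows "submod_valuation (2 * k + 1) (val f)"
proof -
  have mono: "val f S \<le> val f T" if "S \<subseteq> T" "T \<subseteq> M" for S T
  proof (cases "card S = card T")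
    case True
    with that have "S = T"
      by (metis card_subset_eq finite_M finite_subset)
    then show ?thesis by simp
  next
    case False
    then have "card S < card T"
      using that by (metis card_mono finite_M finite_subset le_neq_implies_less)
    then show ?thesis
      using f[of S] f[of T] by (auto simp: val_def)
  qed
  have "val f (T \<union> {x}) - val f T \<le> val f (S \<union> {x}) - val f S"
    if "S \<subseteq> T" "T \<subseteq> M" "x \<in> M" "x \<notin> T" for S T x
  proof (cases "card S = card T")
    case True
    with that have "S = T"
      by (metis card_subset_eq finite_M finite_subset)
    then show ?thesis by simp
  next
    case False
    have fin: "finite S" "finite T"
      using that by (auto intro: finite_subset[OF _ finite_M])
    have "card S < card T"
      using that False fin by (metis card_mono le_neq_implies_less)
    moreover have "card (S \<union> {x}) = Suc (card S)" "card (T \<union> {x}) = Suc (card T)"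
      using that fin by (auto simp: card_insert_if)
    ultimately show ?thesis
      using f[of S] f[of T] f[of "S \<union> {x}"] f[of "T \<union> {x}"]
      by (auto simp: val_def)
  qed
  moreover have "val f {} = 0"
    using k_pos by (simp add: val_def)
  moreover have "0 \<le> val f S" for S
    using f[of S] k_pos by (auto simp: val_def)
  ultimately show ?thesis
    using mono unfolding submod_valuation_def valuation_def submodular_def M_def by auto
qed

text \<open>If one bundle had fewer than \<open>k\<close> goods, the other would keep more than
  \<open>k\<close> after a removal and be envied. So the sizes are \<open>k\<close> and
  \<open>k + 1\<close>, and removing one good from the larger bundle yields exactly the neighbours
  of the smaller one.\<close>

lemma EFX_local_max:
  assumes EFX: "is_EFX_id 2 (2 * k + 1) (val f) A" and f: "\<And>S. 0 \<le> f S" "\<And>S. f S \<le> 1"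
  obtains i where "i < 2" "A i \<in> V" "\<And>S. S \<in> V \<Longrightarrow> A i \<inter> S = {} \<Longrightarrow> f S \<le> f (A i)"
proof -
  have "A 0 \<inter> A 1 = {}" "A 0 \<union> A 1 = M"
    using EFX by (auto simp: is_EFX_id_def is_allocation_def M_def numeral_2_eq_2 lessThan_Suc)
  then have un: "A i \<inter> A (1 - i) = {}" "A i \<union> A (1 - i) = M" if "i < 2" for i
    using that by (auto simp: less_2_cases_iff)
  have fin: "finite (A i)" if "i < 2" for i
    using un[OF that] finite_M by (metis finite_Un)
  have sum: "card (A i) + card (A (1 - i)) = 2 * k + 1" if "i < 2" for i
    using un[OF that] card_Un_disjoint[of "A i" "A (1 - i)"] fin that by (simp add: card_M)
  have "card (A 0) \<le> k \<or> card (A 1) \<le> k"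
    using sum[of 0] by simp linarith
  then obtain i where i: "i < 2" "card (A i) \<le> k"
    by (metis one_less_numeral_iff semiring_norm(76) pos2)
  define B where "B = A (1 - i)"
  have cB: "card B = 2 * k + 1 - card (A i)"
    using sum[OF i(1)] by (simp add: B_def)
  have EF: "val f (B - {g}) \<le> val f (A i)" if "g \<in> B" for g
    using EFX i that unfolding is_EFX_id_def B_def by simp
  have "card (A i) = k"
  proof (rule ccontr)
    assume "card (A i) \<noteq> k"
    with i have less: "card (A i) < k" by simp
    then obtain g where "g \<in> B"
      using cB by (cases "B = {}") auto
    moreover have "card (B - {g}) > k"
      using less cB \<open>g \<in> B\<close> by simp
    ultimately show False
      using EF[of g] less by (simp add: val_def)
  qed
  moreover have "A i \<in> V"
    using un[OF i(1)] \<open>card (A i) = k\<close> by (auto simp: V_def)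
  moreover have "f S \<le> f (A i)" if S: "S \<in> V" "A i \<inter> S = {}" for S
  proof -
    have sub: "S \<subseteq> B"
      using S un[OF i(1)] V_D(1)[OF S(1)] by (auto simp: B_def)
    have finB: "finite B" using fin i by (simp add: B_def)
    have "card (B - S) = 1"
      using sub S cB \<open>card (A i) = k\<close> by (simp add: card_Diff_subset V_D)
    then obtain g where "B - S = {g}"
      by (auto simp: card_1_singleton_iff)
    then have "B - {g} = S" "g \<in> B"
      using sub by auto
    then show ?thesis
      using EF[of g] S \<open>card (A i) = k\<close> by (simp add: val_def V_D)
  qed
  ultimately show thesis
    using that i by blast
qed

section \<open>Random trajectories\<close>

text \<open>Any choice of path will do: uniformity of its vertices comes from the permutations
  applied to it.\<close>

definition path :: "nat set \<Rightarrow> nat \<Rightarrow> nat set" where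
  "path B = (SOME f. f 0 = root \<and> f (2 * k) = B \<and> (\<forall>i<2 * k. (f i, f (Suc i)) \<in> E))"

lemma path:
  assumes "B \<in> V"
  shows "path B 0 = root" "path B (2 * k) = B" "\<And>i. i < 2 * k \<Longrightarrow> (path B i, path B (Suc i)) \<in> E"
proof -
  have "\<exists>f. f 0 = root \<and> f (2 * k) = B \<and> (\<forall>i<2 * k. (f i, f (Suc i)) \<in> E)"
    using E_pow_connected[OF root_V assms] unfolding relpow_fun_conv by simp
  from someI_ex[OF this, folded path_def] show "path B 0 = root" "path B (2 * k) = B"
    "\<And>i. i < 2 * k \<Longrightarrow> (path B i, path B (Suc i)) \<in> E"
    by auto
qed

lemma path_V: "B \<in> V \<Longrightarrow> i < 2 * k \<Longrightarrow> path B i \<in> V"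
  using path(3) by (fastforce simp: E_def)

section \<open>Permutations of the goods and the walks built from them\<close>

definition Sym :: "(nat \<Rightarrow> nat) set" where "Sym = {g. g permutes M}"

lemma finite_Sym: "finite Sym"
  by (simp add: Sym_def finite_permutations finite_M)

lemma Sym_V: "g \<in> Sym \<Longrightarrow> A \<in> V \<Longrightarrow> g ` A \<in> V"
  using image_mono[of A M g]
  by (auto simp: Sym_def V_def permutes_image card_image permutes_inj_on)

lemma Sym_E: "g \<in> Sym \<Longrightarrow> (A, B) \<in> E \<Longrightarrow> (g ` A, g ` B) \<in> E"
  by (auto simp: E_def Sym_V simp flip: image_Int[OF permutes_inj[of g M]])
     (auto simp: Sym_def dest!: permutes_inj injD)

text \<open>The newest factor acts first. Thus \<open>prefix_comp h s\<close> maps a path from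
  \<open>root\<close> to its image under \<open>h s\<close> onto one that starts where the previous
  segment ended.\<close>

primrec prefix_comp :: "(nat \<Rightarrow> nat \<Rightarrow> nat) \<Rightarrow> nat \<Rightarrow> nat \<Rightarrow> nat" where
  "prefix_comp h 0 = id"
| "prefix_comp h (Suc s) = prefix_comp h s \<circ> h s"

lemma prefix_comp_Sym: "(\<And>i. i < s \<Longrightarrow> h i \<in> Sym) \<Longrightarrow> prefix_comp h s \<in> Sym"
proof (induction s)
  case (Suc s)
  then have "prefix_comp h s permutes M" "h s permutes M"
    by (auto simp: Sym_def)
  then show ?case
    by (simp add: Sym_def permutes_compose del: o_apply)
qed (simp add: Sym_def permutes_id)

lemma prefix_comp_cong: "(\<And>i. i < s \<Longrightarrow> h i = h' i) \<Longrightarrow> prefix_comp h s = prefix_comp h' s"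
  by (induction s) auto

text \<open>The walk consists of segments of length \<^term>\<open>2 * k\<close>. Segment \<open>s\<close> is a translate of the fixed path from the
  root to its image under \<open>h s\<close>. The case distinction makes the start of a segment independent of
  \<open>h s\<close>.\<close>
definition traj :: "(nat \<Rightarrow> nat \<Rightarrow> nat) \<Rightarrow> nat \<Rightarrow> nat set" where
  "traj h i = prefix_comp h (i div (2 * k)) `
     (if i mod (2 * k) = 0 then root else path (h (i div (2 * k)) ` root) (i mod (2 * k)))"

lemma traj_segment:
  assumes "h s \<in> Sym" "j \<le> 2 * k"
  shows "traj h (s * (2 * k) + j) = prefix_comp h s ` path (h s ` root) j"
proof -
  have B: "h s ` root \<in> V"
    using assms root_V Sym_V by blast
  show ?thesis
  proof (cases "j = 2 * k")
    case True
    \<comment> \<open>Division assigns this endpoint to segment \<open>Suc s\<close> with remainder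
      0; both descriptions give the same vertex.\<close>
    then have "s * (2 * k) + j = Suc s * (2 * k)" by simp
    then have "traj h (s * (2 * k) + j) = prefix_comp h (Suc s) ` root"
      unfolding traj_def using k_pos by (simp del: mult_Suc prefix_comp.simps)
    then show ?thesis
      using path(2)[OF B] True by (simp add: image_comp)
  next
    case False
    then have "(s * (2 * k) + j) div (2 * k) = s" "(s * (2 * k) + j) mod (2 * k) = j"
      using assms(2) by auto
    then show ?thesis
      using path(1)[OF B] by (simp add: traj_def)
  qed
qed

lemma walk_traj:
  assumes "\<And>s. s < m \<Longrightarrow> h s \<in> Sym"
  shows "walk (traj h) (m * (2 * k))"
proof -
  have "(traj h i, traj h (Suc i)) \<in> E" if i: "i < m * (2 * k)" for i
  proof -
    define s j where "s = i div (2 * k)" and "j = i mod (2 * k)"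
    have ij: "i = s * (2 * k) + j"
      unfolding s_def j_def by (rule div_mult_mod_eq[symmetric])
    have j: "j < 2 * k" and s: "s < m"
      using k_pos i by (auto simp: s_def j_def less_mult_imp_div_less)
    have B: "h s ` root \<in> V"
      using assms[OF s] root_V Sym_V by blast
    have "prefix_comp h s \<in> Sym"
      using assms s by (intro prefix_comp_Sym) auto
    then show ?thesis
      using traj_segment[of h s j] traj_segment[of h s "Suc j"] assms[OF s] j Sym_E path(3)[OF B j]
      by (simp add: ij)
  qed
  then show ?thesis
    by (simp add: walk_def traj_def)
qed

text \<open>The endpoint \<open>t * (2 * k)\<close> is included: it has remainder 0, so
  \<open>traj\<close> does not consult \<open>h t\<close> there.\<close>

lemma traj_cong:
  assumes "\<And>s. s < t \<Longrightarrow> h s = h' s" "i \<le> t * (2 * k)"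
  shows "traj h i = traj h' i"
proof -
  have "i div (2 * k) \<le> t"
    using div_le_mono[OF assms(2), of "2 * k"] k_pos by simp
  moreover have "i div (2 * k) < t" if "i mod (2 * k) \<noteq> 0"
    using that assms(2) by (metis less_mult_imp_div_less le_neq_implies_less mod_mult_self2_is_0)
  moreover have "prefix_comp h (i div (2 * k)) = prefix_comp h' (i div (2 * k))"
    using \<open>i div (2 * k) \<le> t\<close> assms(1) by (intro prefix_comp_cong) auto
  ultimately show ?thesis
    using assms(1) by (simp add: traj_def)
qed

definition H :: "nat \<Rightarrow> (nat \<Rightarrow> nat \<Rightarrow> nat) set" where "H m = {..<m} \<rightarrow>\<^sub>E Sym"

lemma finite_H: "finite (H m)"
  by (simp add: H_def finite_PiE finite_Sym)

lemma H_nonempty: "H m \<noteq> {}"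
  unfolding H_def PiE_eq_empty_iff Sym_def using permutes_id by blast

text \<open>The permutation \<open>h s\<close> alone already makes each position of every segment after the
  \<open>s\<close>-th uniformly distributed.\<close>
lemma card_traj_hit:
  assumes s: "i div (2 * k) = Suc s" "i \<le> m * (2 * k)"
    and U: "\<And>h g. U (h(s := g)) = U h"
  shows "card {h \<in> H m. traj h i = U h} * (2 * k + 1 choose k) \<le> card (H m)"
  unfolding H_def
proof (rule card_PiE_fibre_bound[where i = s])
  have "Suc s \<le> m"
    using div_le_mono[OF s(2), of "2 * k"] k_pos s(1) by simp
  then show "s \<in> {..<m}" by simp
  fix h assume h: "h \<in> {..<m} \<rightarrow>\<^sub>E Sym"
  define A where "A = (if i mod (2 * k) = 0 then root else path (h (Suc s) ` root) (i mod (2 * k)))"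
  \<comment> \<open>At remainder 0 the position may be the end of the whole walk, where
    \<open>h (Suc s)\<close> is no longer a coordinate.\<close>
  have "Suc s < m" if "i mod (2 * k) \<noteq> 0"
    using that s \<open>Suc s \<le> m\<close> by (metis less_mult_imp_div_less le_neq_implies_less mod_mult_self2_is_0)
  then have "h (Suc s) ` root \<in> V" if "i mod (2 * k) \<noteq> 0"
    using that h root_V by (intro Sym_V) (auto dest: PiE_mem)
  then have A: "A \<in> V"
    using k_pos by (simp add: A_def root_V path_V)
  define \<sigma> where "\<sigma> = prefix_comp h s"
  have "\<sigma> \<in> Sym"
    unfolding \<sigma>_def
  proof (rule prefix_comp_Sym)
    fix j assume "j < s"
    then show "h j \<in> Sym"
      using \<open>Suc s \<le> m\<close> by (intro PiE_mem[OF h]) simp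
  qed
  then have inj: "inj \<sigma>"
    by (auto simp: Sym_def permutes_inj)
  have "prefix_comp (h(s := g)) s = \<sigma>" for g
    unfolding \<sigma>_def by (rule prefix_comp_cong) auto
  \<comment> \<open>Neither \<open>\<sigma>\<close> nor \<open>A\<close> depends on
    \<open>g\<close>. As \<open>\<sigma>\<close> is injective, the event is empty or a fibre of the
    action of \<open>g\<close> on \<open>A\<close>.\<close>
  then have traj: "traj (h(s := g)) i = \<sigma> ` g ` A" for g
    using s(1) by (simp add: traj_def A_def image_comp)
  show "card {g \<in> Sym. traj (h(s := g)) i = U (h(s := g))} * (2 * k + 1 choose k) \<le> card Sym"
  proof (cases "\<exists>g\<in>Sym. \<sigma> ` g ` A = U h")
    case True
    then obtain g0 where g0: "g0 \<in> Sym" "\<sigma> ` g0 ` A = U h" by blast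
    then have "{g \<in> Sym. traj (h(s := g)) i = U (h(s := g))} = {g. g permutes M \<and> g ` A = g0 ` A}"
      unfolding U traj g0(2)[symmetric] inj_image_eq_iff[OF inj] by (auto simp: Sym_def)
    moreover have "g0 ` A \<in> V"
      using g0 A Sym_V by blast
    ultimately show ?thesis
      using card_permutes_image_eq[OF finite_M, of A k "g0 ` A"] A
      by (simp add: V_D card_M Sym_def)
  next
    case False
    then have "{g \<in> Sym. traj (h(s := g)) i = U (h(s := g))} = {}"
      by (auto simp: U traj)
    then show ?thesis by (simp only: card.empty mult_0 le0)
  qed
qed (simp_all add: finite_Sym)

section \<open>Few queries do not find the end of a trajectory\<close>

text \<open>For \<open>h\<close> in \<open>H m\<close> the hard instance is
  \<open>partial_val h m\<close>; smaller \<open>t\<close> give the hybrids that know only the first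
  \<open>t\<close> segments.\<close>

definition partial_val :: "(nat \<Rightarrow> nat \<Rightarrow> nat) \<Rightarrow> nat \<Rightarrow> nat set \<Rightarrow> real" where
  "partial_val h t = val (height (traj h) (t * (2 * k)))"

lemma submod_valuation_partial_val: "submod_valuation (2 * k + 1) (partial_val h t)"
  unfolding partial_val_def by (intro submod_valuation_val height_range)

lemma partial_val_cong: "(\<And>s. s < t \<Longrightarrow> h s = h' s) \<Longrightarrow> partial_val h t = partial_val h' t"
  unfolding partial_val_def by (intro arg_cong[of _ _ val] height_cong traj_cong)

lemma EFX_partial_val:
  assumes "is_EFX_id 2 (2 * k + 1) (partial_val h m) A" "h \<in> H m"
  shows "\<exists>i<2. traj h (m * (2 * k)) = A i"
proof -
  obtain i where i: "i < 2" "A i \<in> V" "\<And>S. S \<in> V \<Longrightarrow> A i \<inter> S = {} \<Longrightarrow>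
      height (traj h) (m * (2 * k)) S \<le> height (traj h) (m * (2 * k)) (A i)"
    using EFX_local_max[OF assms(1)[unfolded partial_val_def] height_range] by blast
  have "A i = traj h (m * (2 * k))"
    using assms(2) by (intro height_local_max[OF walk_traj i(2,3)]) (auto simp: H_def)
  with i(1) show ?thesis by auto
qed

text \<open>The query \<open>t\<close> is computed from the first \<open>t\<close> segments only. Hitting segment \<open>t\<close> does not count:
  its start is already known.\<close>
definition bad :: "qtree \<Rightarrow> nat \<Rightarrow> nat \<Rightarrow> (nat \<Rightarrow> nat \<Rightarrow> nat) \<Rightarrow> bool" where
  "bad D m t h \<longleftrightarrow> (let Q = queries D (2 * k + 1) (partial_val h t) in
     t < length Q \<and> (\<exists>i \<in> {Suc t * (2 * k)<..m * (2 * k)}. traj h i = Q ! t))"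

text \<open>Union bound over at most \<open>q * (2 * k)\<close> positions. Each lies in a segment
  \<open>Suc s\<close> with \<open>s \<ge> t\<close>, while query \<open>t\<close> is fixed by the
  permutations before \<open>h t\<close>, so \<open>card_traj_hit\<close> applies with
  \<open>h s\<close>.\<close>

lemma card_bad:
  "card {h \<in> H (Suc q). bad D (Suc q) t h} * (2 * k + 1 choose k) \<le> q * (2 * k) * card (H (Suc q))"
proof -
  let ?m = "Suc q" and ?N = "2 * k + 1 choose k"
  let ?U = "\<lambda>h. queries D (2 * k + 1) (partial_val h t) ! t"
  let ?I = "{Suc t * (2 * k)<..?m * (2 * k)}"
  have hit: "card {h \<in> H ?m. traj h i = ?U h} * ?N \<le> card (H ?m)" if i: "i \<in> ?I" for i
  proof -
    have "Suc t \<le> i div (2 * k)"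
      using i div_le_mono[of "Suc t * (2 * k)" i "2 * k"] k_pos by (simp del: mult_Suc)
    then obtain s where s: "i div (2 * k) = Suc s" "t \<le> s"
      by (metis Suc_le_D Suc_le_mono)
    have "partial_val (h(s := g)) t = partial_val h t" for h g
      using s(2) by (intro partial_val_cong) auto
    with s i show ?thesis
      by (intro card_traj_hit) auto
  qed
  have "{h \<in> H ?m. bad D ?m t h} \<subseteq> (\<Union>i\<in>?I. {h \<in> H ?m. traj h i = ?U h})"
    by (auto simp: bad_def Let_def)
  then have "card {h \<in> H ?m. bad D ?m t h} \<le> card (\<Union>i\<in>?I. {h \<in> H ?m. traj h i = ?U h})"
    by (intro card_mono) (auto simp: finite_H)
  also have "\<dots> \<le> (\<Sum>i\<in>?I. card {h \<in> H ?m. traj h i = ?U h})"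
    by (intro card_UN_le) simp
  finally have "card {h \<in> H ?m. bad D ?m t h} * ?N \<le> (\<Sum>i\<in>?I. card {h \<in> H ?m. traj h i = ?U h} * ?N)"
    by (simp add: sum_distrib_right[symmetric])
  also have "\<dots> \<le> (\<Sum>i\<in>?I. card (H ?m))"
    by (intro sum_mono hit)
  also have "\<dots> = card ?I * card (H ?m)"
    by simp
  also have "card ?I \<le> q * (2 * k)"
    by (simp add: algebra_simps)
  finally show ?thesis by simp
qed

text \<open>By strong induction on \<open>t\<close>, the real run and the run on hybrid
  \<open>t\<close> agree through query \<open>t\<close>: each earlier query \<open>i\<close> avoids
  everything after segment \<open>i\<close>, so truncating the walk to \<open>t\<close> segments
  keeps its answer.\<close>

lemma qout_not_bad:
  assumes good: "\<And>t. t < q \<Longrightarrow> \<not> bad D (Suc q) t h"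
    and count: "qcount D (2 * k + 1) (partial_val h (Suc q)) \<le> q"
  shows "qout D (2 * k + 1) (partial_val h (Suc q)) = qout D (2 * k + 1) (partial_val h q)"
proof -
  let ?Q = "\<lambda>t. queries D (2 * k + 1) (partial_val h t)"
  let ?m = "Suc q"
  have agree: "\<forall>S \<in> set (take t (?Q ?m)). partial_val h ?m S = partial_val h t S"
    if t: "t \<le> q" and IH: "\<And>i. i < t \<Longrightarrow> take (Suc i) (?Q ?m) = take (Suc i) (?Q i)" for t
  proof
    fix S assume "S \<in> set (take t (?Q ?m))"
    then obtain i where i: "i < t" "i < length (?Q ?m)" "S = ?Q ?m ! i"
      by (auto simp: in_set_conv_nth)
    then have "i < length (take (Suc i) (?Q i))"
      unfolding IH[OF i(1), symmetric] by simp
    then have len: "i < length (?Q i)" by simp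
    have "S = ?Q i ! i"
      using i(3) IH[OF i(1)] by (metis lessI nth_take)
    then have *: "traj h j \<noteq> S" if "Suc i * (2 * k) < j" "j \<le> ?m * (2 * k)" for j
      using good[of i] i(1) t len that by (auto simp: bad_def Let_def)
    have "Suc i * (2 * k) \<le> t * (2 * k)"
      using i(1) by (intro mult_right_mono) auto
    then have "height (traj h) (?m * (2 * k)) S = height (traj h) (t * (2 * k)) S"
      using t by (intro height_truncate * mult_right_mono) linarith+
    then show "partial_val h ?m S = partial_val h t S"
      by (simp add: partial_val_def val_def)
  qed
  have take: "take (Suc t) (?Q ?m) = take (Suc t) (?Q t)" if "t \<le> q" for t
    using that
  proof (induction t rule: less_induct)
    case (less t)
    show ?case
    proof (rule queries_agree, rule agree[OF less.prems])
      fix i assume "i < t"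
      with less show "take (Suc i) (?Q ?m) = take (Suc i) (?Q i)"
        by simp
    qed
  qed
  have "take q (?Q ?m) = ?Q ?m"
    using count by (simp add: length_queries)
  with agree[of q] take show ?thesis
    by (intro qout_agree) auto
qed

text \<open>Without a bad query the output is computed from \<open>q\<close> segments, hence
  independent of \<open>h q\<close>, which alone makes the end of the walk uniform. Each of the two
  bundles equals that end with probability at most \<open>1 / ?N\<close>.\<close>

lemma card_success:
  "card {h \<in> H (Suc q). qcount D (2 * k + 1) (partial_val h (Suc q)) \<le> q \<and>
      is_EFX_id 2 (2 * k + 1) (partial_val h (Suc q)) (qout D (2 * k + 1) (partial_val h (Suc q)))}
    * (2 * k + 1 choose k) \<le> (q * q * (2 * k) + 2) * card (H (Suc q))"
  (is "card ?S * ?N \<le> _")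
proof -
  let ?m = "Suc q"
  let ?out = "\<lambda>h. qout D (2 * k + 1) (partial_val h q)"
  let ?B = "\<lambda>t. {h \<in> H ?m. bad D ?m t h}"
  let ?F = "\<lambda>i. {h \<in> H ?m. traj h (?m * (2 * k)) = ?out h i}"
  have "card (?F i) * ?N \<le> card (H ?m)" for i
  proof (rule card_traj_hit)
    show "?m * (2 * k) div (2 * k) = Suc q"
      using k_pos by (simp del: mult_Suc)
    have "partial_val (h(q := g)) q = partial_val h q" for h g
      by (intro partial_val_cong) auto
    then show "?out (h(q := g)) i = ?out h i" for h g by simp
  qed simp
  then have F: "(\<Sum>i<2. card (?F i) * ?N) \<le> (\<Sum>i<2::nat. card (H ?m))"
    by (intro sum_mono)
  have B: "(\<Sum>t<q. card (?B t) * ?N) \<le> (\<Sum>t<q. q * (2 * k) * card (H ?m))"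
    by (intro sum_mono card_bad)
  have "?S \<subseteq> (\<Union>t<q. ?B t) \<union> (\<Union>i<2. ?F i)"
  proof
    fix h assume h: "h \<in> ?S"
    then have "\<exists>i<2. traj h (?m * (2 * k)) = qout D (2 * k + 1) (partial_val h ?m) i"
      by (intro EFX_partial_val) auto
    moreover have "qout D (2 * k + 1) (partial_val h ?m) = ?out h" if "\<And>t. t < q \<Longrightarrow> \<not> bad D ?m t h"
      using h that by (intro qout_not_bad) auto
    ultimately show "h \<in> (\<Union>t<q. ?B t) \<union> (\<Union>i<2. ?F i)"
      using h by (cases "\<exists>t<q. bad D ?m t h") auto
  qed
  then have "card ?S \<le> card ((\<Union>t<q. ?B t) \<union> (\<Union>i<2. ?F i))"
    by (intro card_mono) (auto simp: finite_H)
  also have "\<dots> \<le> card (\<Union>t<q. ?B t) + card (\<Union>i<2. ?F i)"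
    by (rule card_Un_le)
  also have "\<dots> \<le> (\<Sum>t<q. card (?B t)) + (\<Sum>i<2. card (?F i))"
    by (intro add_mono card_UN_le) auto
  finally have "card ?S * ?N \<le> ((\<Sum>t<q. card (?B t)) + (\<Sum>i<2. card (?F i))) * ?N"
    by (rule mult_right_mono) simp
  also have "\<dots> = (\<Sum>t<q. card (?B t) * ?N) + (\<Sum>i<2. card (?F i) * ?N)"
    by (simp add: distrib_right sum_distrib_right)
  also have "\<dots> \<le> (\<Sum>t<q. q * (2 * k) * card (H ?m)) + (\<Sum>i<2::nat. card (H ?m))"
    by (intro add_mono B F)
  also have "\<dots> = (q * q * (2 * k) + 2) * card (H ?m)"
    by (simp add: algebra_simps)
  finally show ?thesis .
qed

text \<open>The easy direction of Yao's principle: every fixed seed solves few instances, so the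
  average success probability over instances is small, yet it must be at least 2/3.\<close>

lemma query_bound:
  assumes corr: "rand_correct 2 (2 * k + 1) P Alg"
    and count: "\<And>v \<omega>. submod_valuation (2 * k + 1) v \<Longrightarrow> \<omega> \<in> space P \<Longrightarrow> qcount (Alg \<omega>) (2 * k + 1) v \<le> q"
  shows "real (2 * k + 1 choose k) \<le> 3 * (real k * (real q)\<^sup>2 + 1)"
proof -
  let ?m = "Suc q" and ?N = "2 * k + 1 choose k"
  interpret prob_space P
    using corr by (simp add: rand_correct_def)
  define S where "S h = {\<omega> \<in> space P. is_EFX_id 2 (2 * k + 1) (partial_val h ?m)
      (qout (Alg \<omega>) (2 * k + 1) (partial_val h ?m))}" for h
  have S: "S h \<in> events" "2 / 3 \<le> prob (S h)" for h
    using corr submod_valuation_partial_val unfolding rand_correct_def S_def Let_def by auto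
  \<comment> \<open>\<open>C\<close> bounds the number of instances in \<open>H ?m\<close> solved by
    one deterministic tree.\<close>
  define C where "C = real (q * q * (2 * k) + 2) * real (card (H ?m)) / real ?N"
  have N: "real ?N > 0" by (simp add: binomial_eq_0_iff)
  have pointwise: "(\<Sum>h\<in>H ?m. indicator (S h) \<omega>) \<le> C" if \<omega>: "\<omega> \<in> space P" for \<omega>
  proof -
    have "(\<Sum>h\<in>H ?m. indicator (S h) \<omega>) = real (card {h \<in> H ?m. \<omega> \<in> S h})"
      using finite_H by (simp add: indicator_def sum.If_cases Int_def)
    moreover have "{h \<in> H ?m. \<omega> \<in> S h} = {h \<in> H ?m. qcount (Alg \<omega>) (2 * k + 1) (partial_val h ?m) \<le> q \<and>
      is_EFX_id 2 (2 * k + 1) (partial_val h ?m) (qout (Alg \<omega>) (2 * k + 1) (partial_val h ?m))}"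
      using \<omega> count[OF submod_valuation_partial_val \<omega>] by (auto simp: S_def)
    then have "card {h \<in> H ?m. \<omega> \<in> S h} * ?N \<le> (q * q * (2 * k) + 2) * card (H ?m)"
      using card_success by presburger
    then have "real (card {h \<in> H ?m. \<omega> \<in> S h} * ?N) \<le> real ((q * q * (2 * k) + 2) * card (H ?m))"
      by (rule of_nat_mono)
    then have "real (card {h \<in> H ?m. \<omega> \<in> S h}) \<le> C"
      unfolding C_def by (subst pos_le_divide_eq[OF N]) (simp only: of_nat_mult)
    ultimately show ?thesis by simp
  qed
  have "2 / 3 * real (card (H ?m)) = (\<Sum>h\<in>H ?m. 2 / 3)"
    by simp
  also have "\<dots> \<le> (\<Sum>h\<in>H ?m. prob (S h))"
    by (intro sum_mono S)
  also have "\<dots> = (\<Sum>h\<in>H ?m. expectation (indicator (S h)))"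
    using S by simp
  also have "\<dots> = expectation (\<lambda>\<omega>. \<Sum>h\<in>H ?m. indicator (S h) \<omega>)"
    using S by (intro Bochner_Integration.integral_sum[symmetric]) (auto simp: emeasure_eq_measure)
  also have "\<dots> \<le> expectation (\<lambda>\<omega>. C)"
    using S by (intro integral_mono pointwise Bochner_Integration.integrable_sum) (auto simp: emeasure_eq_measure)
  also have "\<dots> = C"
    by (simp add: prob_space)
  finally have "2 / 3 * real ?N * real (card (H ?m)) \<le> real (q * q * (2 * k) + 2) * real (card (H ?m))"
    using N unfolding C_def by (simp add: field_simps)
  moreover have "real (card (H ?m)) > 0"
    using finite_H H_nonempty by (simp add: card_gt_0_iff)
  ultimately have "2 / 3 * real ?N \<le> real (q * q * (2 * k) + 2)"
    by (rule mult_right_le_imp_le)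
  then show ?thesis
    by (simp add: power2_eq_square algebra_simps)
qed

end

text \<open>\<open>query_bound\<close> yields order \<open>sqrt (N / k)\<close>, so the factor
  \<open>1 / k^2\<close> leaves slack. With fewer than \<open>x\<close> queries it gives
  \<open>N \<le> N / 3 + 3\<close>, which fails once \<open>N\<close> exceeds 9/2.\<close>

theorem theorem3p9:
  shows "\<exists>c>0. \<exists>K::nat. \<forall>k\<ge>K.
     ennreal (c * sqrt (real ((2*k+1) choose k)) / (real k)^2) \<le> R_sub_EFX_id 2 (2*k+1)"
proof (intro exI conjI allI impI)
  show "(0::real) < 1 / 3" by simp
  fix k :: nat assume k: "3 \<le> k"
  then interpret odd_graph k by unfold_locales simp
  define N where "N = real (2 * k + 1 choose k)"
  define x where "x = 1 / 3 * sqrt N / (real k)\<^sup>2"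
  have "(2::real) ^ 3 \<le> 2 ^ k"
    using k by (intro power_increasing) auto
  also have "\<dots> \<le> (real (2 * k + 1) / real k) ^ k"
    using k by (intro power_mono) (auto simp: field_simps)
  also have "\<dots> \<le> N"
    unfolding N_def by (rule binomial_ge_n_over_k_pow_k) simp
  finally have N: "8 \<le> N" by simp
  have "ennreal x \<le> worst_cost (2 * k + 1) P Alg" if corr: "rand_correct 2 (2 * k + 1) P Alg" for P Alg
  proof (rule ccontr)
    assume "\<not> ennreal x \<le> worst_cost (2 * k + 1) P Alg"
    then have less: "worst_cost (2 * k + 1) P Alg < ennreal x" by simp
    \<comment> \<open>Query counts are integers below \<open>x\<close>, so rounding down keeps them
      bounded by \<open>q\<close>.\<close>
    define q where "q = nat \<lfloor>x\<rfloor>"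
    have x0: "0 \<le> x" using N by (simp add: x_def)
    have "qcount (Alg \<omega>) (2 * k + 1) v \<le> q"
      if "submod_valuation (2 * k + 1) v" "\<omega> \<in> space P" for v \<omega>
    proof -
      have "of_nat (qcount (Alg \<omega>) (2 * k + 1) v) \<le> worst_cost (2 * k + 1) P Alg"
        unfolding worst_cost_def using that by (intro SUP_upper2[of v] SUP_upper2[of \<omega>]) auto
      also note less
      finally have "real (qcount (Alg \<omega>) (2 * k + 1) v) < x"
        by (simp add: ennreal_of_nat_eq_real_of_nat ennreal_less_iff)
      then show ?thesis
        unfolding q_def by (simp add: le_nat_floor)
    qed
    from query_bound[OF corr this] have "N \<le> 3 * (real k * (real q)\<^sup>2 + 1)"
      by (simp add: N_def)
    also have "real q \<le> x"
      using x0 by (simp add: q_def)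
    then have "real k * (real q)\<^sup>2 \<le> real k * x\<^sup>2"
      by (intro mult_left_mono power_mono) auto
    also have "\<dots> = N / (9 * real k ^ 3)"
      using N k by (simp add: x_def power_divide power_mult_distrib field_simps eval_nat_numeral)
    also have "\<dots> \<le> N / 9"
      using N k by (intro divide_left_mono) auto
    finally show False using N by simp
  qed
  then show "ennreal (1 / 3 * sqrt (real (2 * k + 1 choose k)) / (real k)\<^sup>2) \<le> R_sub_EFX_id 2 (2 * k + 1)"
    unfolding R_sub_EFX_id_def by (intro INF_greatest) (auto simp: x_def N_def)
qed

end
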